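(* Let $c>0$ and $d\ge 1$ be arbitrary constants and let $\epsilon>0$ be any constant. Then for all sufficiently large $n$ (with $cn$ an integer), with probability at least $1-1/n$, the largest bin load after all balls have been placed by $\mathrm{GREEDY}(cn,n,d)$ is less than $$\frac{(2+\epsilon)\log n}{\log\log n-\log d-\log c}.$$
   Context: $\mathrm{GREEDY}(m,n,d)$ places $m$ balls into $n$ bins $B_1,\dots,B_n$ over time steps $t=1,\dots,m$. At each time step, $d$ indices are selected from $[n]=\{1,\dots,n\}$ independently and uniformly at random with replacement, forming a multiset $S_t$; the $t$-th ball is placed into a bin $B_M$ with $M\in S_t$ whose current load is maximal among the bins indexed by $S_t$; ties among maximal bins are broken uniformly at random. The load of a bin is the number of balls in it. $\log$ denotes the natural logarithm. *)

theory Defs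
  imports "HOL-Probability.Probability"
begin

text \<open>
  Bins are indexed by \<open>{1..n}\<close>, and a configuration \<open>L :: nat \<Rightarrow> nat\<close> gives the load \<open>L i\<close> of bin \<open>i\<close>.
\<close>

definition sample_bins :: "nat \<Rightarrow> nat \<Rightarrow> nat multiset pmf" where
  "sample_bins n d = map_pmf mset (replicate_pmf d (pmf_of_set {1..n}))"

definition fullest_bins :: "(nat \<Rightarrow> nat) \<Rightarrow> nat multiset \<Rightarrow> nat set" where
  "fullest_bins L S = {M. M \<in># S \<and> (\<forall>j. j \<in># S \<longrightarrow> L j \<le> L M)}"

text \<open>
  Ties are broken uniformly among the distinct fullest bins: the multiplicity with which a bin
  was sampled gives it no extra weight.
\<close>

definition place_ball :: "nat \<Rightarrow> nat \<Rightarrow> (nat \<Rightarrow> nat) \<Rightarrow> (nat \<Rightarrow> nat) pmf" where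
  "place_ball n d L =
     bind_pmf (sample_bins n d) (\<lambda>S.
       map_pmf (\<lambda>M. L(M := L M + 1)) (pmf_of_set (fullest_bins L S)))"

primrec greedy :: "nat \<Rightarrow> nat \<Rightarrow> nat \<Rightarrow> (nat \<Rightarrow> nat) pmf" where
  "greedy 0 n d = return_pmf (\<lambda>_. 0)"
| "greedy (Suc t) n d = bind_pmf (greedy t n d) (place_ball n d)"

definition max_load :: "nat \<Rightarrow> (nat \<Rightarrow> nat) \<Rightarrow> nat" where
  "max_load n L = Max (L ` {1..n})"

end

theory Submission
  imports Defs "HOL-Real_Asymp.Real_Asymp"
begin

text \<open>
  Whatever the current loads, a fixed bin can receive the next ball only if it is sampled, which
  happens with probability at most \<open>d / n\<close>. Hence, for \<open>z \<ge> 1\<close>, each step multiplies \<open>E z\<^sup>L\<close> for the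
  load \<open>L\<close> of a fixed bin by at most \<open>1 + (z - 1) d / n\<close>, so that finally \<open>E z\<^sup>L \<le> exp (c d z)\<close>.
  A Chernoff bound with \<open>z = \<epsilon> ln n / (2 c d)\<close> and a union bound over the bins give the claim.
\<close>

text \<open>A union bound over the \<open>d\<close> draws, carried out by induction: a hit occurs
  either in the first draw or among the remaining ones.\<close>

lemma prob_mem_replicate_pmf_le:
  "measure_pmf.prob (replicate_pmf d p) {xs. x \<in> set xs} \<le> real d * pmf p x"
proof (induction d)
  case 0
  then show ?case by simp
next
  case (Suc d)
  let ?R = "replicate_pmf d p"
  have "emeasure (replicate_pmf (Suc d) p) {xs. x \<in> set xs}
      = (\<integral>\<^sup>+y. \<integral>\<^sup>+ys. indicator {xs. x \<in> set xs} (y # ys) \<partial>?R \<partial>p)"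
    by (simp add: emeasure_bind_pmf)
  also have "\<dots> \<le> (\<integral>\<^sup>+y. \<integral>\<^sup>+ys. indicator {x} y + indicator {xs. x \<in> set xs} ys \<partial>?R \<partial>p)"
    by (intro nn_integral_mono) (auto simp: indicator_def)
  also have "\<dots> = ennreal (pmf p x) + emeasure ?R {xs. x \<in> set xs}"
    by (simp add: nn_integral_add emeasure_pmf_single)
  also have "\<dots> = ennreal (pmf p x + measure_pmf.prob ?R {xs. x \<in> set xs})"
    by (simp add: measure_pmf.emeasure_eq_measure)
  finally have "measure_pmf.prob (replicate_pmf (Suc d) p) {xs. x \<in> set xs}
      \<le> pmf p x + measure_pmf.prob ?R {xs. x \<in> set xs}"
    by (simp add: measure_pmf.emeasure_eq_measure del: ennreal_plus)
  with Suc.IH show ?case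
    by (simp add: algebra_simps)
qed

lemma prob_mem_sample_bins_le:
  assumes "n \<ge> 1"
  shows "measure_pmf.prob (sample_bins n d) {S. i \<in># S} \<le> real d / real n"
proof -
  have "measure_pmf.prob (sample_bins n d) {S. i \<in># S}
      \<le> real d * pmf (pmf_of_set {1..n}) i"
    using prob_mem_replicate_pmf_le[of d "pmf_of_set {1..n}" i]
    by (simp add: sample_bins_def vimage_def)
  \<comment> \<open>The index \<open>i\<close> is arbitrary: outside \<open>{1..n}\<close> its pmf
    is 0, inside it is \<open>1 / n\<close>.\<close>
  also have "\<dots> \<le> real d * (1 / real n)"
    using assms by (intro mult_left_mono) (auto simp: indicator_def)
  finally show ?thesis by simp
qed

lemma set_pmf_sample_bins_nonempty:
  assumes "d \<ge> 1" "S \<in> set_pmf (sample_bins n d)"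
  shows "S \<noteq> {#}"
  using assms by (auto simp: sample_bins_def set_replicate_pmf)

lemma finite_fullest_bins: "finite (fullest_bins L S)"
  by (rule finite_subset[of _ "set_mset S"]) (auto simp: fullest_bins_def)

text \<open>Together with finiteness, this ensures that \<open>pmf_of_set (fullest_bins L S)\<close>
  really is uniform on that set, so that a bin in its support belongs to the sample.\<close>

lemma fullest_bins_nonempty:
  assumes "S \<noteq> {#}"
  shows "fullest_bins L S \<noteq> {}"
proof -
  have "Max (L ` set_mset S) \<in> L ` set_mset S"
    using assms by (intro Max_in) auto
  then obtain M where "M \<in># S" "L M = Max (L ` set_mset S)"
    by force
  then have "M \<in> fullest_bins L S"
    by (auto simp: fullest_bins_def)
  then show ?thesis by blast
qed

text \<open>Condition on the sample \<open>S\<close>. The receiving bin lies in \<open>S\<close>, so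
  \<open>L i\<close> is unchanged if \<open>i\<close> is not in \<open>S\<close> and grows by at
  most one otherwise. Thus \<open>z ^ L i\<close> gains at most the factor
  \<open>1 + (z - 1) * indicator\<close>, whose mean involves only the probability of sampling
  \<open>i\<close>.\<close>

lemma nn_integral_place_ball_le:
  fixes z :: real
  assumes "z \<ge> 1" "d \<ge> 1" "n \<ge> 1"
  shows "(\<integral>\<^sup>+L'. ennreal (z ^ L' i) \<partial>place_ball n d L)
    \<le> ennreal (1 + (z - 1) * (real d / real n)) * ennreal (z ^ L i)"
proof -
  let ?p = "measure_pmf.prob (sample_bins n d) {S. i \<in># S}"
  \<comment> \<open>The right-hand side no longer depends on the chosen bin \<open>M\<close>, so the
    tie-breaking distribution integrates out.\<close>
  have choice: "(\<integral>\<^sup>+M. ennreal (z ^ (L(M := L M + 1)) i) \<partial>pmf_of_set (fullest_bins L S))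
      \<le> ennreal (z ^ L i) * (1 + ennreal (z - 1) * indicator {S. i \<in># S} S)"
    if S: "S \<in> set_pmf (sample_bins n d)" for S
  proof -
    have M: "M \<in># S" if "M \<in> set_pmf (pmf_of_set (fullest_bins L S))" for M
      using that set_pmf_of_set[OF fullest_bins_nonempty finite_fullest_bins]
        set_pmf_sample_bins_nonempty[OF assms(2) S]
      by (auto simp: fullest_bins_def)
    have le: "ennreal (z ^ (L(M := L M + 1)) i)
        \<le> ennreal (z ^ L i) * (1 + ennreal (z - 1) * indicator {S. i \<in># S} S)"
      if "M \<in> set_pmf (pmf_of_set (fullest_bins L S))" for M
    proof (cases "i \<in># S")
      case True
      have "1 + ennreal (z - 1) = ennreal z"
        using assms(1) by (simp flip: ennreal_1 ennreal_plus)
      moreover have "z ^ (L(M := L M + 1)) i \<le> z ^ Suc (L i)"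
        using assms(1) by (intro power_increasing) auto
      ultimately show ?thesis
        using True assms(1) by (simp add: mult.commute ennreal_leI flip: ennreal_mult)
    next
      case False
      with M[OF that] have "M \<noteq> i" by blast
      with False show ?thesis by simp
    qed
    have "(\<integral>\<^sup>+M. ennreal (z ^ (L(M := L M + 1)) i) \<partial>pmf_of_set (fullest_bins L S))
        \<le> (\<integral>\<^sup>+M. ennreal (z ^ L i) * (1 + ennreal (z - 1) * indicator {S. i \<in># S} S)
              \<partial>pmf_of_set (fullest_bins L S))"
      by (intro nn_integral_mono_AE) (use le in \<open>simp add: AE_measure_pmf_iff\<close>)
    then show ?thesis by simp
  qed
  have "(\<integral>\<^sup>+L'. ennreal (z ^ L' i) \<partial>place_ball n d L)
      = (\<integral>\<^sup>+S. \<integral>\<^sup>+M. ennreal (z ^ (L(M := L M + 1)) i) \<partial>pmf_of_set (fullest_bins L S)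
          \<partial>sample_bins n d)"
    by (simp only: place_ball_def nn_integral_bind_pmf nn_integral_map_pmf)
  also have "\<dots> \<le> (\<integral>\<^sup>+S. ennreal (z ^ L i) * (1 + ennreal (z - 1) * indicator {S. i \<in># S} S)
          \<partial>sample_bins n d)"
    by (intro nn_integral_mono_AE) (use choice in \<open>simp add: AE_measure_pmf_iff\<close>)
  also have "\<dots> = ennreal (z ^ L i) * (1 + ennreal (z - 1) * ennreal ?p)"
    by (simp add: nn_integral_cmult nn_integral_add measure_pmf.emeasure_eq_measure)
  also have "1 + ennreal (z - 1) * ennreal ?p = ennreal (1 + (z - 1) * ?p)"
    using assms(1) by (simp add: ennreal_mult)
  also have "ennreal (z ^ L i) * ennreal (1 + (z - 1) * ?p)
      \<le> ennreal (z ^ L i) * ennreal (1 + (z - 1) * (real d / real n))"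
    using assms(1) prob_mem_sample_bins_le[OF assms(3), of d i]
    by (intro mult_left_mono ennreal_leI add_left_mono) auto
  finally show ?thesis
    by (simp add: mult.commute)
qed

text \<open>The one-step factor is the same for every configuration, so it leaves the integral and
  the steps multiply.\<close>

lemma nn_integral_greedy_le:
  fixes z :: real
  assumes "z \<ge> 1" "d \<ge> 1" "n \<ge> 1"
  shows "(\<integral>\<^sup>+L. ennreal (z ^ L i) \<partial>greedy m n d)
    \<le> ennreal ((1 + (z - 1) * (real d / real n)) ^ m)"
proof (induction m)
  case 0
  then show ?case by simp
next
  case (Suc m)
  let ?q = "1 + (z - 1) * (real d / real n)"
  have "(\<integral>\<^sup>+L. ennreal (z ^ L i) \<partial>greedy (Suc m) n d)
      = (\<integral>\<^sup>+L. \<integral>\<^sup>+L'. ennreal (z ^ L' i) \<partial>place_ball n d L \<partial>greedy m n d)"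
    by (simp add: nn_integral_bind_pmf)
  also have "\<dots> \<le> (\<integral>\<^sup>+L. ennreal ?q * ennreal (z ^ L i) \<partial>greedy m n d)"
    by (intro nn_integral_mono nn_integral_place_ball_le assms)
  also have "\<dots> = ennreal ?q * (\<integral>\<^sup>+L. ennreal (z ^ L i) \<partial>greedy m n d)"
    by (simp add: nn_integral_cmult)
  also have "\<dots> \<le> ennreal ?q * ennreal (?q ^ m)"
    by (intro mult_left_mono Suc.IH) simp
  also have "\<dots> = ennreal (?q ^ Suc m)"
    using assms(1) by (simp add: ennreal_mult)
  finally show ?case .
qed

text \<open>Markov's inequality for the sum of \<open>z ^ L i\<close> over all bins. This performs
  the Chernoff and union bounds at once, whence the factor \<open>n\<close>. The threshold
  \<open>K\<close> is real, hence \<open>powr\<close>.\<close>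

lemma prob_max_load_ge_le:
  fixes z K :: real
  assumes z: "z \<ge> 1" and "d \<ge> 1" "n \<ge> 1"
  shows "measure_pmf.prob (greedy m n d) {L. K \<le> real (max_load n L)}
    \<le> real n * exp (real m * real d / real n * z) / z powr K"
proof -
  let ?A = "{L. K \<le> real (max_load n L)}"
  let ?G = "greedy m n d"
  have "1 + (z - 1) * (real d / real n) \<le> exp ((z - 1) * (real d / real n))"
    by (rule exp_ge_add_one_self)
  then have "(1 + (z - 1) * (real d / real n)) ^ m \<le> exp ((z - 1) * (real d / real n)) ^ m"
    using z by (intro power_mono) auto
  also have "\<dots> = exp (real m * ((z - 1) * (real d / real n)))"
    by (rule exp_of_nat_mult[symmetric])
  \<comment> \<open>Replacing \<open>z - 1\<close> by \<open>z\<close> loses only the factor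
    \<open>exp (m d / n)\<close>, a constant when \<open>m = c n\<close>.\<close>
  also have "\<dots> \<le> exp (real m * real d / real n * z)"
  proof -
    have "(z - 1) * (real m * real d / real n) \<le> z * (real m * real d / real n)"
      by (intro mult_right_mono) auto
    then show ?thesis by (simp add: mult_ac)
  qed
  finally have q: "(1 + (z - 1) * (real d / real n)) ^ m \<le> exp (real m * real d / real n * z)" .
  have markov: "ennreal (z powr K) * indicator ?A L \<le> (\<Sum>i=1..n. ennreal (z ^ L i))" for L
  proof (cases "L \<in> ?A")
    case True
    have "max_load n L \<in> L ` {1..n}"
      unfolding max_load_def using assms(3) by (intro Max_in) auto
    then obtain i where i: "i \<in> {1..n}" "max_load n L = L i" by blast
    with True have "z powr K \<le> z powr real (L i)"
      using z by (intro powr_mono) auto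
    also have "\<dots> = z ^ L i"
      using z by (simp add: powr_realpow)
    finally have "ennreal (z powr K) \<le> ennreal (z ^ L i)" by (rule ennreal_leI)
    also have "\<dots> \<le> (\<Sum>i=1..n. ennreal (z ^ L i))"
      using i by (intro member_le_sum) auto
    finally show ?thesis using True by simp
  qed simp
  have "ennreal (z powr K) * emeasure ?G ?A = (\<integral>\<^sup>+L. ennreal (z powr K) * indicator ?A L \<partial>?G)"
    by (simp add: nn_integral_cmult)
  also have "\<dots> \<le> (\<integral>\<^sup>+L. (\<Sum>i=1..n. ennreal (z ^ L i)) \<partial>?G)"
    by (intro nn_integral_mono markov)
  also have "\<dots> = (\<Sum>i=1..n. \<integral>\<^sup>+L. ennreal (z ^ L i) \<partial>?G)"
    by (simp add: nn_integral_sum)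
  also have "\<dots> \<le> (\<Sum>i=1..n. ennreal (exp (real m * real d / real n * z)))"
    by (intro sum_mono order.trans[OF nn_integral_greedy_le[OF assms]] ennreal_leI q)
  also have "\<dots> = ennreal (real n * exp (real m * real d / real n * z))"
    by (simp add: ennreal_mult ennreal_of_nat_eq_real_of_nat)
  finally have "z powr K * measure_pmf.prob ?G ?A
      \<le> real n * exp (real m * real d / real n * z)"
    by (simp add: measure_pmf.emeasure_eq_measure flip: ennreal_mult)
  then show ?thesis
    using z by (simp add: field_simps)
qed

theorem theorem3p2:
  fixes c \<epsilon> :: real and d :: nat
  assumes "c > 0" and "d \<ge> 1" and "\<epsilon> > 0"
  shows "\<forall>\<^sub>F n :: nat in sequentially. \<forall>m :: nat. real m = c * real n \<longrightarrow>
           measure_pmf.prob (greedy m n d)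
             {L. real (max_load n L) <
                 (2 + \<epsilon>) * ln (real n) / (ln (ln (real n)) - ln (real d) - ln c)}
           \<ge> 1 - 1 / real n"
proof -
  define a where "a = c * real d"
  \<comment> \<open>Half of the slack \<epsilon> pays for the growth of the moment; the other half
    absorbs the vanishing term \<open>ln \<delta> / D n\<close>.\<close>
  define \<delta> where "\<delta> = \<epsilon> / 2"
  have a: "a > 0" and \<delta>: "\<delta> > 0" and ln_a: "ln a = ln c + ln (real d)"
    using assms by (simp_all add: a_def \<delta>_def ln_mult)
  define D where "D n = ln (ln (real n)) - ln (real d) - ln c" for n :: nat
  have D_pos: "\<forall>\<^sub>F n in sequentially. D n > 0"
    unfolding D_def by real_asymp
  have z_ge: "\<forall>\<^sub>F n :: nat in sequentially. \<delta> * ln (real n) / a \<ge> 1"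
    using a \<delta> by real_asymp
  \<comment> \<open>The denominator \<open>D n\<close>, which is \<open>ln (ln n / a)\<close>, tends
    to infinity while \<open>ln \<delta>\<close> is fixed.\<close>
  have "(\<lambda>n. (2 + \<epsilon>) * (1 + ln \<delta> / D n)) \<longlonglongrightarrow> 2 + \<epsilon>"
    unfolding D_def by real_asymp
  moreover have "2 + \<delta> < 2 + \<epsilon>"
    using assms(3) by (simp add: \<delta>_def)
  ultimately have exponent: "\<forall>\<^sub>F n in sequentially. 2 + \<delta> < (2 + \<epsilon>) * (1 + ln \<delta> / D n)"
    by (rule order_tendstoD(1))
  show ?thesis
    using D_pos z_ge exponent eventually_gt_at_top[of 1]
  proof eventually_elim
    case (elim n)
    \<comment> \<open>This is as large as the moment bound allows: the exponent
      \<open>m d z / n\<close> becomes \<open>\<delta> * ln n\<close>, so the moment is at most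
      \<open>n powr \<delta>\<close>, while \<open>ln z\<close> differs from \<open>D n\<close> only
      by a constant.\<close>
    define z where "z = \<delta> * ln (real n) / a"
    define K where "K = (2 + \<epsilon>) * ln (real n) / D n"
    have n: "ln (real n) > 0" using elim(4) by simp
    have ln_z: "ln z = D n + ln \<delta>"
      using n a \<delta> by (simp add: z_def D_def ln_a ln_mult ln_div)
    have z: "z \<ge> 1" using elim(2) by (simp add: z_def)
    show ?case
    proof (intro allI impI)
      fix m :: nat
      assume m: "real m = c * real n"
      let ?G = "greedy m n d"
      have "real m * real d / real n * z = \<delta> * ln (real n)"
        using m elim(4) assms by (simp add: z_def a_def)
      moreover have "z powr K = exp ((2 + \<epsilon>) * (1 + ln \<delta> / D n) * ln (real n))"
        using z elim(1) by (simp add: powr_def ln_z K_def field_simps)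
      ultimately have "real n * exp (real m * real d / real n * z) / z powr K
          = exp (ln (real n) + \<delta> * ln (real n) - (2 + \<epsilon>) * (1 + ln \<delta> / D n) * ln (real n))"
        using elim(4) by (simp add: exp_diff exp_add)
      \<comment> \<open>By the choice of \<open>n\<close>, the coefficient of \<open>ln n\<close> is
        below \<open>1 + \<delta> - (2 + \<delta>) = -1\<close>. The 2 in the bound thus covers one
        power of \<open>n\<close> for the union bound and one for the failure probability.\<close>
      also have "\<dots> \<le> exp (- ln (real n))"
        using mult_strict_right_mono[OF elim(3) n] by (simp add: algebra_simps)
      also have "\<dots> = 1 / real n"
        using elim(4) by (simp add: exp_minus field_simps)
      finally have "measure_pmf.prob ?G {L. K \<le> real (max_load n L)} \<le> 1 / real n"
        using prob_max_load_ge_le[OF z assms(2), of n m K] elim(4) by simp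
      moreover have "{L. real (max_load n L) < K} = UNIV - {L. K \<le> real (max_load n L)}"
        by auto
      ultimately have "measure_pmf.prob ?G {L. real (max_load n L) < K} \<ge> 1 - 1 / real n"
        using measure_pmf.prob_compl[of "{L. K \<le> real (max_load n L)}" ?G] by simp
      then show "measure_pmf.prob ?G {L. real (max_load n L) <
          (2 + \<epsilon>) * ln (real n) / (ln (ln (real n)) - ln (real d) - ln c)} \<ge> 1 - 1 / real n"
        by (simp add: K_def D_def)
    qed
  qed
qed

end
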